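(* Let $(X,\mathcal{S})$ be an $S$-metric space, let $f:X\to X$ be a self-mapping, let $0\le a<1$ be the number used in the definition of $M_S(x,y)$, and let $\mu=\inf\{\mathcal{S}(x,x,fx): x\neq fx,\ x\in X\}$. Suppose there exist a simulation function $\zeta\in\mathcal{Z}$ and a point $x_0\in X$ such that (i) for all $x\in C_{x_0,\mu}^S$ there exists a $\delta(\mu)>0$ satisfying $$\frac{\mu}{4}\le M_S(x,x_0)<\frac{\mu}{4}+\delta(\mu)\ \Longrightarrow\ \mathcal{S}(fx,fx,x_0)\le\mu;$$ (ii) for all $x\in X$, $$\mathcal{S}(fx,fx,x)>0\ \Longrightarrow\ \zeta\big(\mathcal{S}(fx,fx,x),M_S(x,x_0)\big)\ge 0.$$ Then $x_0\in Fix(f)$ and the circle $C_{x_0,\mu}^S$ is a fixed circle of $f$, that is, $fx=x$ for all $x\in C_{x_0,\mu}^S$.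
   Context: An $S$-metric on a nonempty set $X$ is a function $\mathcal{S}:X^3\to[0,\infty)$ such that for all $x,y,z,a\in X$: (1) $\mathcal{S}(x,y,z)=0$ if and only if $x=y=z$; (2) $\mathcal{S}(x,y,z)\le\mathcal{S}(x,x,a)+\mathcal{S}(y,y,a)+\mathcal{S}(z,z,a)$. Then $(X,\mathcal{S})$ is an $S$-metric space; it satisfies $\mathcal{S}(x,x,y)=\mathcal{S}(y,y,x)$ for all $x,y\in X$. $\mathcal{Z}$ is the set of simulation functions: functions $\zeta:[0,\infty)\times[0,\infty)\to\mathbb{R}$ such that ($\zeta_1$) $\zeta(0,0)=0$; ($\zeta_2$) $\zeta(t,s)<s-t$ for all $s,t>0$; ($\zeta_3$) if $\{t_n\},\{s_n\}$ are sequences in $(0,\infty)$ with $\lim_{n\to\infty}t_n=\lim_{n\to\infty}s_n>0$, then $\limsup_{n\to\infty}\zeta(t_n,s_n)<0$. Write $fx=f(x)$ and $Fix(f)=\{x\in X: fx=x\}$. For a fixed number $0\le a<1$, $$M_S(x,y)=\max\left\{a\mathcal{S}(x,x,fx)+(1-a)\mathcal{S}(y,y,fy),\ (1-a)\mathcal{S}(x,x,fx)+a\mathcal{S}(y,y,fy),\ \frac{\mathcal{S}(x,x,fy)+\mathcal{S}(y,y,fx)}{4}\right\}.$$ The circle is $C_{x_0,r}^S=\{x\in X:\mathcal{S}(x,x,x_0)=r\}$. *)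

theory Defs
  imports Complex_Main "HOL-Library.FuncSet" "HOL-Library.Extended_Real"
begin

locale S_metric_space =
  fixes X :: "'a set" and S :: "'a \<Rightarrow> 'a \<Rightarrow> 'a \<Rightarrow> real"
  assumes nonempty: "X \<noteq> {}"
    and nonneg: "\<lbrakk>x \<in> X; y \<in> X; z \<in> X\<rbrakk> \<Longrightarrow> 0 \<le> S x y z"
    and zero_iff: "\<lbrakk>x \<in> X; y \<in> X; z \<in> X\<rbrakk> \<Longrightarrow> S x y z = 0 \<longleftrightarrow> x = y \<and> y = z"
    and triangle: "\<lbrakk>x \<in> X; y \<in> X; z \<in> X; a \<in> X\<rbrakk>
      \<Longrightarrow> S x y z \<le> S x x a + S y y a + S z z a"

text \<open>
  A simulation function has domain \<open>[0,\<infinity>) \<times> [0,\<infinity>)\<close>; values of \<open>\<zeta>\<close> at negative arguments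
  are unconstrained. The upper limit is taken in the extended reals, since the sequence
  \<open>\<zeta> (t n) (s n)\<close> need not be bounded below, and its upper limit may be \<open>-\<infinity>\<close>.
\<close>

definition simulation_function :: "(real \<Rightarrow> real \<Rightarrow> real) \<Rightarrow> bool" where
  "simulation_function \<zeta> \<longleftrightarrow>
     \<zeta> 0 0 = 0 \<and>
     (\<forall>t>0. \<forall>s>0. \<zeta> t s < s - t) \<and>
     (\<forall>t s l. (\<forall>n. 0 < t n) \<longrightarrow> (\<forall>n. 0 < s n) \<longrightarrow> t \<longlonglongrightarrow> l \<longrightarrow> s \<longlonglongrightarrow> l \<longrightarrow> 0 < l \<longrightarrow>
        limsup (\<lambda>n. ereal (\<zeta> (t n) (s n))) < 0)"

definition Fix :: "'a set \<Rightarrow> ('a \<Rightarrow> 'a) \<Rightarrow> 'a set" where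
  "Fix X f = {x \<in> X. f x = x}"

definition M_S :: "('a \<Rightarrow> 'a \<Rightarrow> 'a \<Rightarrow> real) \<Rightarrow> ('a \<Rightarrow> 'a) \<Rightarrow> real \<Rightarrow> 'a \<Rightarrow> 'a \<Rightarrow> real" where
  "M_S S f a x y = Max {a * S x x (f x) + (1 - a) * S y y (f y),
                        (1 - a) * S x x (f x) + a * S y y (f y),
                        (S x x (f y) + S y y (f x)) / 4}"

definition circle_S :: "'a set \<Rightarrow> ('a \<Rightarrow> 'a \<Rightarrow> 'a \<Rightarrow> real) \<Rightarrow> 'a \<Rightarrow> real \<Rightarrow> 'a set" where
  "circle_S X S x0 r = {x \<in> X. S x x x0 = r}"

text \<open>
  The infimum is over a set of nonnegative reals. If every point of \<open>X\<close> is fixed by \<open>f\<close> the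
  set is empty and the value is the unspecified real \<open>Inf {}\<close>.
\<close>

definition mu_S :: "'a set \<Rightarrow> ('a \<Rightarrow> 'a \<Rightarrow> 'a \<Rightarrow> real) \<Rightarrow> ('a \<Rightarrow> 'a) \<Rightarrow> real" where
  "mu_S X S f = Inf {S x x (f x) | x. x \<in> X \<and> x \<noteq> f x}"

definition fixed_circle :: "('a \<Rightarrow> 'a) \<Rightarrow> 'a set \<Rightarrow> bool" where
  "fixed_circle f C \<longleftrightarrow> (\<forall>x\<in>C. f x = x)"

end

theory Submission
  imports Defs
begin

text \<open>
  If \<open>f x \<noteq> x\<close>, then \<open>\<zeta>\<^sub>2\<close> turns the hypothesis \<open>\<zeta> (S (f x) (f x) x) (M x x0) \<ge> 0\<close> into
  \<open>S (f x) (f x) x < M x x0\<close>. At \<open>x = x0\<close> this is absurd, since \<open>M x0 x0 = S x0 x0 (f x0)\<close>.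
  At a point \<open>x\<close> of the circle, with \<open>t = S x x (f x)\<close>, the first two entries of the maximum are
  at most \<open>t\<close> because \<open>x0\<close> is fixed, and the third is at most \<open>(2 \<mu> + 2 t) / 4\<close> by the
  triangle inequality; since \<open>\<mu> \<le> t\<close>, this is again at most \<open>t\<close>.
\<close>

context S_metric_space
begin

lemma self_zero: "x \<in> X \<Longrightarrow> S x x x = 0"
  using zero_iff by blast

text \<open>Taking the first point as the fourth one in \<open>triangle\<close> leaves a single
  nonzero term on the right.\<close>

lemma sym:
  assumes "x \<in> X" "y \<in> X"
  shows "S x x y = S y y x"
  using triangle[of x x y x] triangle[of y y x y] assms by (simp add: self_zero)

lemma pos: "\<lbrakk>x \<in> X; y \<in> X; x \<noteq> y\<rbrakk> \<Longrightarrow> 0 < S x x y"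
  using nonneg[of x x y] zero_iff[of x x y] by fastforce

text \<open>The nonfixed \<open>x\<close> makes the set nonempty, so the unspecified
  \<open>Inf {}\<close> does not arise; nonnegativity of \<open>S\<close> bounds the set
  below.\<close>

lemma mu_S_le:
  assumes "f \<in> X \<rightarrow> X" "x \<in> X" "f x \<noteq> x"
  shows "mu_S X S f \<le> S x x (f x)"
  unfolding mu_S_def
proof (rule cInf_lower)
  show "S x x (f x) \<in> {S x x (f x) |x. x \<in> X \<and> x \<noteq> f x}"
    using assms by force
  show "bdd_below {S x x (f x) |x. x \<in> X \<and> x \<noteq> f x}"
    using assms(1) nonneg by (intro bdd_belowI[of _ 0]) auto
qed

end

text \<open>The weights \<open>a\<close> and \<open>1 - a\<close> sum to 1, and the third entry is
  half of the common value of the first two.\<close>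

lemma M_S_diagonal:
  assumes "0 \<le> S x x (f x)"
  shows "M_S S f a x x = S x x (f x)"
  using assms by (simp add: M_S_def algebra_simps)

lemma simulation_functionD:
  assumes "simulation_function \<zeta>" "0 < t" "0 < s" "0 \<le> \<zeta> t s"
  shows "t < s"
  using assms unfolding simulation_function_def by fastforce

theorem theorem2p8:
  fixes X :: "'a set" and S :: "'a \<Rightarrow> 'a \<Rightarrow> 'a \<Rightarrow> real" and f :: "'a \<Rightarrow> 'a"
    and a \<mu> :: real and \<zeta> :: "real \<Rightarrow> real \<Rightarrow> real" and x0 :: 'a
  assumes "S_metric_space X S"
    and "f \<in> X \<rightarrow> X"
    and "0 \<le> a" and "a < 1"
    and "\<mu> = mu_S X S f"
    and "simulation_function \<zeta>"
    and "x0 \<in> X"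
    and "\<forall>x \<in> circle_S X S x0 \<mu>. \<exists>\<delta>>0.
           \<mu> / 4 \<le> M_S S f a x x0 \<and> M_S S f a x x0 < \<mu> / 4 + \<delta>
             \<longrightarrow> S (f x) (f x) x0 \<le> \<mu>"
    and "\<forall>x \<in> X. S (f x) (f x) x > 0 \<longrightarrow> \<zeta> (S (f x) (f x) x) (M_S S f a x x0) \<ge> 0"
  shows "x0 \<in> Fix X f \<and> fixed_circle f (circle_S X S x0 \<mu>)"
proof -
  interpret S_metric_space X S by fact
  have fX: "f x \<in> X" if "x \<in> X" for x
    using assms(2) that by blast
  have less: "S x x (f x) < M_S S f a x x0"
    if "x \<in> X" "f x \<noteq> x" "0 < M_S S f a x x0" for x
    using that assms(9) simulation_functionD[OF assms(6)] pos[of "f x" x] sym[of x "f x"] fX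
    by auto
  have fix0: "f x0 = x0"
  proof (rule ccontr)
    assume ne: "f x0 \<noteq> x0"
    then have "0 < S x0 x0 (f x0)"
      using pos[of x0 "f x0"] fX assms(7) by metis
    then show False
      using less[OF assms(7) ne] M_S_diagonal[of S x0 f a] by simp
  qed
  have "f x = x" if x: "x \<in> X" "S x x x0 = \<mu>" for x
  proof (rule ccontr)
    assume ne: "f x \<noteq> x"
    define t where "t = S x x (f x)"
    have t0: "0 < t"
      using pos[of x "f x"] fX x ne unfolding t_def by metis
    have M: "M_S S f a x x0 = Max {a * t, (1 - a) * t, (\<mu> + S x0 x0 (f x)) / 4}"
      using x by (simp add: M_S_def fix0 self_zero assms(7) t_def)
    \<comment> \<open>The bound on \<open>\<zeta>\<close> is available only at positive arguments;
      the second entry makes the maximum positive even if \<open>a = 0\<close>.\<close>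
    have "0 < (1 - a) * t"
      using t0 assms(4) by simp
    then have "0 < M_S S f a x x0"
      unfolding M by (auto simp: less_max_iff_disj)
    with x ne have "t < M_S S f a x x0"
      unfolding t_def by (intro less)
    moreover have "a * t \<le> t" "(1 - a) * t \<le> t"
      using t0 assms(3,4) by (simp_all add: mult_le_cancel_right1)
    moreover have "\<mu> \<le> t"
      using mu_S_le[OF assms(2) x(1) ne] assms(5) unfolding t_def by simp
    \<comment> \<open>After symmetry, \<open>triangle\<close> through \<open>x\<close> counts the
      distance from \<open>f x\<close> to \<open>x\<close> twice.\<close>
    moreover have "S x0 x0 (f x) \<le> 2 * t + \<mu>"
      using triangle[of "f x" "f x" x0 x] sym[of x "f x"] sym[of x x0] sym[of x0 "f x"]
        fX x assms(7) unfolding t_def by simp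
    ultimately show False
      unfolding M by (auto simp: less_max_iff_disj)
  qed
  then show ?thesis
    using fix0 assms(7) by (simp add: Fix_def fixed_circle_def circle_S_def)
qed

end
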